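(* Consider $P:\mathcal R\times\mathcal R\to[0,1]$ as a smooth function on the 6-dimensional manifold $\mathcal R\times\mathcal R$. Every critical point of $P$ is either a global minimum (where $P=0$), a saddle point, a second-order trap, or a global maximum (where $P=\tfrac{3}{50}(9+\sqrt6)$).
   Context: Basis of $\mathbb C^3$: $|1\rangle,|2\rangle,|3\rangle$ (standard basis). Spin-1 matrices in this basis: $J_y=\frac{1}{\sqrt2}\begin{pmatrix}0&-i&0\\ i&0&-i\\ 0&i&0\end{pmatrix}$, $J_z=\mathrm{diag}(1,0,-1)$. Define $Z(\alpha,\beta,\gamma)=e^{-i\alpha J_z}e^{-i\beta J_y}e^{-i\gamma J_z}$. Let $\mathcal R=\{Z(\alpha,\beta,\gamma):\alpha,\beta,\gamma\in\mathbb R\}\subset U(3)$ (the image of $SU(2)$ under its spin-1 representation, a compact 3-dimensional Lie subgroup of $U(3)$). For $j\in\{1,2\}$ let $P_j=|j\rangle\langle j|$ and $\mathcal M_j(\rho)=P_j\rho P_j+(\mathbb I-P_j)\rho(\mathbb I-P_j)$. Define $P(U_1,U_2)=\langle 2|U_2\,\mathcal M_1(U_1|1\rangle\langle 1|U_1^\dagger)\,U_2^\dagger|2\rangle$ for $U_1,U_2\in\mathcal R$. A critical point is a point where the differential of $P$ vanishes; a saddle point is a critical point that is neither a local maximum nor a local minimum; a second-order trap is a critical point that is not a global maximum and at which the Hessian is negative semidefinite but not negative definite. *)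

theory Defs
  imports "HOL-Analysis.Analysis"
begin

type_synonym cmat = "complex ^ 3 ^ 3"

definition csmult :: "complex \<Rightarrow> cmat \<Rightarrow> cmat" where
  "csmult c A = (\<chi> i j. c * A $ i $ j)"

definition adj :: "cmat \<Rightarrow> cmat" where
  "adj A = (\<chi> i j. cnj (A $ j $ i))"

primrec mpow :: "cmat \<Rightarrow> nat \<Rightarrow> cmat" where
  "mpow A 0 = mat 1"
| "mpow A (Suc n) = A ** mpow A n"

definition mexp :: "cmat \<Rightarrow> cmat" where
  "mexp A = (\<chi> i j. (\<Sum>n. (mpow A n) $ i $ j / of_nat (fact n)))"

text \<open>Spin-1 matrices in the standard basis |1>,|2>,|3> (indices 1,2,3 of type 3).\<close>
definition Jy :: cmat where
  "Jy = (\<chi> i j.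
     if i = 1 \<and> j = 2 then - \<i> / complex_of_real (sqrt 2)
     else if i = 2 \<and> j = 1 then \<i> / complex_of_real (sqrt 2)
     else if i = 2 \<and> j = 3 then - \<i> / complex_of_real (sqrt 2)
     else if i = 3 \<and> j = 2 then \<i> / complex_of_real (sqrt 2)
     else 0)"

definition Jz :: cmat where
  "Jz = (\<chi> i j. if i = j then (if i = 1 then 1 else if i = 3 then -1 else 0) else 0)"

text \<open>J_x obtained from the commutation relation [J_y,J_z] = i J_x.\<close>
definition Jx :: cmat where
  "Jx = csmult (- \<i>) (Jy ** Jz - Jz ** Jy)"

definition Zrot :: "real \<Rightarrow> real \<Rightarrow> real \<Rightarrow> cmat" where
  "Zrot a b c = mexp (csmult (- \<i> * of_real a) Jz) ** mexp (csmult (- \<i> * of_real b) Jy)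
                ** mexp (csmult (- \<i> * of_real c) Jz)"

definition Rgrp :: "cmat set" where
  "Rgrp = {Zrot a b c | a b c. True}"

definition proj :: "3 \<Rightarrow> cmat" where
  "proj k = (\<chi> i j. if i = k \<and> j = k then 1 else 0)"

definition Mmeas :: "3 \<Rightarrow> cmat \<Rightarrow> cmat" where
  "Mmeas k \<rho> = proj k ** \<rho> ** proj k + (mat 1 - proj k) ** \<rho> ** (mat 1 - proj k)"

text \<open>P(U1,U2) = <2| U2 M_1(U1 |1><1| U1^dagger) U2^dagger |2> (a real number; we take Re).\<close>
definition Pfun :: "cmat \<Rightarrow> cmat \<Rightarrow> real" where
  "Pfun U1 U2 = Re ((U2 ** Mmeas 1 (U1 ** proj 1 ** adj U1) ** adj U2) $ 2 $ 2)"

text \<open>Lie algebra element i-times: coefficients v in R^3 give X = v1 Jx + v2 Jy + v3 Jz;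
  the curve t |-> U exp(-i t X) through U in R.\<close>
definition gen :: "real ^ 3 \<Rightarrow> cmat" where
  "gen v = csmult (of_real (v $ 1)) Jx + csmult (of_real (v $ 2)) Jy + csmult (of_real (v $ 3)) Jz"

definition curve :: "cmat \<Rightarrow> real ^ 3 \<Rightarrow> real \<Rightarrow> cmat" where
  "curve U v t = U ** mexp (csmult (- \<i> * of_real t) (gen v))"

definition Pcurve :: "cmat \<Rightarrow> cmat \<Rightarrow> real ^ 3 \<Rightarrow> real ^ 3 \<Rightarrow> real \<Rightarrow> real" where
  "Pcurve U1 U2 v w t = Pfun (curve U1 v t) (curve U2 w t)"

definition critical :: "cmat \<Rightarrow> cmat \<Rightarrow> bool" where
  "critical U1 U2 \<longleftrightarrow> U1 \<in> Rgrp \<and> U2 \<in> Rgrp \<and>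
     (\<forall>v w. (Pcurve U1 U2 v w has_real_derivative 0) (at 0))"

definition hess :: "cmat \<Rightarrow> cmat \<Rightarrow> real ^ 3 \<Rightarrow> real ^ 3 \<Rightarrow> real" where
  "hess U1 U2 v w = deriv (deriv (Pcurve U1 U2 v w)) 0"

definition local_max :: "cmat \<Rightarrow> cmat \<Rightarrow> bool" where
  "local_max U1 U2 \<longleftrightarrow> (\<exists>e>0. \<forall>V1\<in>Rgrp. \<forall>V2\<in>Rgrp.
      dist (V1, V2) (U1, U2) < e \<longrightarrow> Pfun V1 V2 \<le> Pfun U1 U2)"

definition local_min :: "cmat \<Rightarrow> cmat \<Rightarrow> bool" where
  "local_min U1 U2 \<longleftrightarrow> (\<exists>e>0. \<forall>V1\<in>Rgrp. \<forall>V2\<in>Rgrp.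
      dist (V1, V2) (U1, U2) < e \<longrightarrow> Pfun U1 U2 \<le> Pfun V1 V2)"

definition global_max :: "cmat \<Rightarrow> cmat \<Rightarrow> bool" where
  "global_max U1 U2 \<longleftrightarrow> (\<forall>V1\<in>Rgrp. \<forall>V2\<in>Rgrp. Pfun V1 V2 \<le> Pfun U1 U2)"

definition global_min :: "cmat \<Rightarrow> cmat \<Rightarrow> bool" where
  "global_min U1 U2 \<longleftrightarrow> (\<forall>V1\<in>Rgrp. \<forall>V2\<in>Rgrp. Pfun U1 U2 \<le> Pfun V1 V2)"

definition saddle :: "cmat \<Rightarrow> cmat \<Rightarrow> bool" where
  "saddle U1 U2 \<longleftrightarrow> critical U1 U2 \<and> \<not> local_max U1 U2 \<and> \<not> local_min U1 U2"

definition second_order_trap :: "cmat \<Rightarrow> cmat \<Rightarrow> bool" where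
  "second_order_trap U1 U2 \<longleftrightarrow> critical U1 U2 \<and> \<not> global_max U1 U2 \<and>
     (\<forall>v w. hess U1 U2 v w \<le> 0) \<and>
     \<not> (\<forall>v w. (v, w) \<noteq> 0 \<longrightarrow> hess U1 U2 v w < 0)"

end

theory Submission
  imports Defs
begin

text \<open>In Euler angles, \<open>P\<close> depends only on \<open>\<beta>\<^sub>1\<close>, \<open>\<beta>\<^sub>2\<close> and \<open>\<phi> = \<alpha>\<^sub>1 + \<gamma>\<^sub>2\<close>, and for fixed \<open>\<beta>\<^sub>1\<close>, \<open>\<phi>\<close>
  it is a binary quadratic form in \<open>(cos \<beta>\<^sub>2, sin \<beta>\<^sub>2)\<close>. A critical point that is neither a local
  minimum nor a local maximum is a saddle. At a local maximum the Hessian is negative semidefinite,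
  and it is degenerate because \<open>U\<^sub>1 \<mapsto> U\<^sub>1 exp(-i t J\<^sub>z)\<close> leaves \<open>P\<close> unchanged; so a local maximum is
  a second-order trap unless it is global. What remains is to compute the maximum, from the larger
  eigenvalue of the form, and to show that \<open>P = 0\<close> at every local minimum. If
  \<open>x = cos \<beta>\<^sub>1\<close> is not \<open>\<plusminus>1\<close>, local minimality forces \<open>cos \<phi> = \<plusminus>1\<close> and
  \<open>(x\<^sup>2 + x - 1) (5 x\<^sup>2 - 2 x - 1) = 0\<close>; the roots of the second factor violate the second-order
  condition in \<open>\<beta>\<^sub>2\<close>, and those of the first the one in \<open>\<beta>\<^sub>1\<close>.\<close>

subsection \<open>The spin-1 representation of SU(2)\<close>

text \<open>Since \<open>Y ** Y ** Y = Y\<close>, odd powers collapse to \<open>Y\<close> and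
  positive even powers to \<open>Y ** Y\<close>, so the exponential series splits into a sine series
  and a cosine series.\<close>

lemma sums_entry_mexp:
  assumes Y: "Y ** Y ** Y = Y"
  shows "(\<lambda>n. mpow (csmult (- \<i> * of_real k) Y) n $ i $ j / of_nat (fact n)) sums
    ((mat 1 :: cmat) $ i $ j - \<i> * of_real (sin k) * Y $ i $ j + (of_real (cos k) - 1) * (Y ** Y) $ i $ j)"
proof -
  have Y3: "Y ** (Y ** Y) = Y" using Y by (simp add: matrix_mul_assoc)
  have sm: "csmult c A ** csmult d B = csmult (c * d) (A ** B)" for c d A B
    by (simp add: csmult_def matrix_matrix_mult_def vec_eq_iff sum_distrib_left mult_ac)
  have pw: "mpow (csmult c Y) (Suc (2*m)) = csmult (c ^ Suc (2*m)) Y \<and>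
       mpow (csmult c Y) (Suc (Suc (2*m))) = csmult (c ^ Suc (Suc (2*m))) (Y ** Y)" for c m
  proof (induction m)
    case 0
    show ?case by (simp add: sm)
  next
    case (Suc m)
    then show ?case by (simp add: sm Y3)
  qed
  let ?c = "- \<i> * of_real k"
  \<comment> \<open>The even powers from \<open>n = 2\<close> on are multiples of \<open>Y\<^sup>2\<close>, but the power at \<open>n = 0\<close> is the identity.\<close>
  have eq: "mpow (csmult ?c Y) n $ i $ j / of_nat (fact n) =
     (if n = 0 then (mat 1 :: cmat) $ i $ j - (Y ** Y) $ i $ j else 0)
      + of_real (sin_coeff n * k ^ n) * (- \<i> * Y $ i $ j)
      + of_real (cos_coeff n * k ^ n) * (Y ** Y) $ i $ j" for n
  proof (cases "n = 0")
    case True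
    then show ?thesis by simp
  next
    case n0: False
    show ?thesis
    proof (cases "even n")
      case True
      then obtain m where n: "n = Suc (Suc (2*m))"
        using n0 by (metis dvdE mult_Suc_right not0_implies_Suc add_2_eq_Suc mult_0_right)
      have "?c ^ n = of_real ((-1) ^ (n div 2) * k ^ n)"
        unfolding power_mult_distrib n by (simp add: power_mult power_minus')
      moreover have "mpow (csmult ?c Y) n = csmult (?c ^ n) (Y ** Y)"
        using pw[of ?c m] unfolding n by blast
      ultimately have "mpow (csmult ?c Y) n $ i $ j
          = of_real ((-1) ^ (n div 2) * k ^ n) * (Y ** Y) $ i $ j"
        by (simp only: csmult_def vec_lambda_beta)
      then show ?thesis using True n0 by (simp add: sin_coeff_def cos_coeff_def)
    next
      case False
      then obtain m where n: "n = Suc (2*m)" by (metis oddE Suc_eq_plus1)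
      have "?c ^ n = - \<i> * of_real ((-1) ^ ((n - Suc 0) div 2) * k ^ n)"
        unfolding power_mult_distrib n by (simp add: power_mult power_minus')
      moreover have "mpow (csmult ?c Y) n = csmult (?c ^ n) Y"
        using pw[of ?c m] unfolding n by blast
      ultimately have "mpow (csmult ?c Y) n $ i $ j
          = - \<i> * of_real ((-1) ^ ((n - Suc 0) div 2) * k ^ n) * Y $ i $ j"
        by (simp only: csmult_def vec_lambda_beta)
      then show ?thesis using False n0 by (simp add: sin_coeff_def cos_coeff_def)
    qed
  qed
  have s: "(\<lambda>n. complex_of_real (sin_coeff n * k ^ n)) sums of_real (sin k)"
    using sin_converges[of k] unfolding sums_of_real_iff by simp
  have c: "(\<lambda>n. complex_of_real (cos_coeff n * k ^ n)) sums of_real (cos k)"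
    using cos_converges[of k] unfolding sums_of_real_iff by simp
  have "(\<lambda>n. mpow (csmult ?c Y) n $ i $ j / of_nat (fact n)) sums
     ((mat 1 :: cmat) $ i $ j - (Y ** Y) $ i $ j + of_real (sin k) * (- \<i> * Y $ i $ j)
      + of_real (cos k) * (Y ** Y) $ i $ j)"
    unfolding eq
    by (intro sums_add sums_mult2 s c) (rule sums_single)
  then show ?thesis by (simp add: algebra_simps)
qed

lemma mexp_cubic:
  assumes "Y ** Y ** Y = Y"
  shows "mexp (csmult (- \<i> * of_real k) Y) =
    (\<chi> i j. (mat 1 :: cmat) $ i $ j - \<i> * of_real (sin k) * Y $ i $ j + (of_real (cos k) - 1) * (Y ** Y) $ i $ j)"
  unfolding mexp_def using sums_entry_mexp[OF assms] by (simp add: vec_eq_iff sums_iff)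

text \<open>The symmetric square of the SU(2) matrix with first column \<open>(a, b)\<close>, in the basis
  \<open>e\<^sub>1\<^sup>2\<close>, \<open>\<surd>2 e\<^sub>1 e\<^sub>2\<close>, \<open>e\<^sub>2\<^sup>2\<close>.\<close>

definition rho :: "complex \<Rightarrow> complex \<Rightarrow> cmat" where
  "rho a b = vector
    [vector [a\<^sup>2, - of_real (sqrt 2) * a * cnj b, (cnj b)\<^sup>2],
     vector [of_real (sqrt 2) * a * b, a * cnj a - b * cnj b, - of_real (sqrt 2) * cnj a * cnj b],
     vector [b\<^sup>2, of_real (sqrt 2) * cnj a * b, (cnj a)\<^sup>2]]"

lemma sqrt2_sq: "complex_of_real (sqrt 2) * of_real (sqrt 2) = 2"
  "complex_of_real (sqrt 2) * (of_real (sqrt 2) * z) = 2 * z"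
  by (simp_all flip: of_real_mult mult.assoc)

text \<open>The symmetric square is multiplicative on matrices with columns \<open>(a, b)\<close>
  and \<open>(- cnj b, cnj a)\<close>; the arguments on the right are the first column of the
  product.\<close>

lemma rho_mult: "rho a b ** rho c d = rho (a * c - cnj b * d) (b * c + cnj a * d)"
  by (simp add: vec_eq_iff forall_3 rho_def matrix_matrix_mult_def sum_3)
   (simp add: algebra_simps power2_eq_square sqrt2_sq)

section \<open>Rotations about an arbitrary unit axis\<close>

lemma gen_eq: "gen v = vector
  [vector [of_real (v $ 3), (of_real (v $ 1) - \<i> * of_real (v $ 2)) / of_real (sqrt 2), 0],
   vector [(of_real (v $ 1) + \<i> * of_real (v $ 2)) / of_real (sqrt 2), 0,
      (of_real (v $ 1) - \<i> * of_real (v $ 2)) / of_real (sqrt 2)],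
   vector [0, (of_real (v $ 1) + \<i> * of_real (v $ 2)) / of_real (sqrt 2), - of_real (v $ 3)]]"
  by (simp add: gen_def Jx_def Jy_def Jz_def csmult_def vec_eq_iff forall_3 matrix_matrix_mult_def
      sum_3 field_simps)

lemma norm_vec3: "(norm (u :: real ^ 3))\<^sup>2 = (u $ 1)\<^sup>2 + (u $ 2)\<^sup>2 + (u $ 3)\<^sup>2"
  by (simp add: norm_vec_def L2_set_def sum_3)

lemma gen_scaleR: "gen (r *\<^sub>R u) = csmult (of_real r) (gen u)"
  by (simp add: gen_def csmult_def vec_eq_iff algebra_simps)

text \<open>The spin component along a unit axis has eigenvalues 1, 0, -1, whence the cubic
  relation. The arguments of \<open>rho\<close> are the first column of the spin-1/2 rotation by
  \<open>k\<close> about \<open>u\<close>, so half angles appear.\<close>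

lemma gen_unit_cubic:
  assumes "norm u = 1"
  shows "gen u ** gen u ** gen u = gen u"
    and "(\<chi> i j. (mat 1 :: cmat) $ i $ j - \<i> * of_real (sin k) * gen u $ i $ j
            + (of_real (cos k) - 1) * (gen u ** gen u) $ i $ j)
      = rho (of_real (cos (k/2)) - \<i> * of_real (sin (k/2)) * of_real (u $ 3))
            (- \<i> * of_real (sin (k/2)) * (of_real (u $ 1) + \<i> * of_real (u $ 2)))"
proof -
  define x y z s where "x = complex_of_real (u $ 1)" and "y = complex_of_real (u $ 2)"
    and "z = complex_of_real (u $ 3)" and "s = complex_of_real (sqrt 2)"
  have "(u $ 1)\<^sup>2 + (u $ 2)\<^sup>2 + (u $ 3)\<^sup>2 = 1"
    using norm_vec3[of u] assms by simp
  then have n: "x\<^sup>2 + y\<^sup>2 + z\<^sup>2 = 1"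
    unfolding x_def y_def z_def of_real_power[symmetric] of_real_add[symmetric] by simp
  \<comment> \<open>Absorbing \<open>1 / s\<close> into the off-diagonal entries leaves polynomial
    identities modulo \<open>2 * (p * q) + z\<^sup>2 = 1\<close> and, later,
    \<open>c\<^sup>2 + d\<^sup>2 = 1\<close>.\<close>
  define p q where "p = (x + \<i> * y) / s" and "q = (x - \<i> * y) / s"
  have s: "s * s = 2" "s \<noteq> 0" by (simp_all add: s_def sqrt2_sq)
  have pq: "2 * (p * q) + z\<^sup>2 = 1"
  proof -
    have "2 * (p * q) = (x + \<i> * y) * (x - \<i> * y) * (2 / (s * s))"
      by (simp add: p_def q_def)
    also have "\<dots> = x\<^sup>2 + y\<^sup>2"
      unfolding s by (simp add: algebra_simps power2_eq_square)
    finally show ?thesis using n by simp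
  qed
  have g: "gen u = vector [vector [z, q, 0], vector [p, 0, q], vector [0, p, - z]]"
    by (simp add: gen_eq x_def y_def z_def p_def q_def s_def)
  have g2: "gen u ** gen u = vector [vector [z\<^sup>2 + p * q, z * q, q\<^sup>2],
      vector [z * p, 2 * (p * q), - z * q], vector [p\<^sup>2, - z * p, z\<^sup>2 + p * q]]"
    unfolding g by (simp add: vec_eq_iff forall_3 matrix_matrix_mult_def sum_3 power2_eq_square)
  have z2': "z\<^sup>2 = 1 - 2 * (p * q)"
    using pq by (simp add: algebra_simps)
  have zz: "z * z = 1 - 2 * (p * q)" "z * (z * w) = w - 2 * (p * (q * w))" for w
    using z2' by (simp_all add: power2_eq_square left_diff_distrib flip: mult.assoc)
  show "gen u ** gen u ** gen u = gen u"
    unfolding g2 unfolding g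
    by (simp add: vec_eq_iff forall_3 matrix_matrix_mult_def sum_3,
        simp add: algebra_simps power2_eq_square, simp add: zz algebra_simps)
  define c d where "c = complex_of_real (cos (k/2))" and "d = complex_of_real (sin (k/2))"
  have cd: "c\<^sup>2 + d\<^sup>2 = 1"
    unfolding c_def d_def by (simp flip: of_real_power of_real_add)
  have "cos k = (cos (k/2))\<^sup>2 - (sin (k/2))\<^sup>2" "sin k = 2 * sin (k/2) * cos (k/2)"
    using cos_double[of "k/2"] sin_double[of "k/2"] by simp_all
  then have k: "complex_of_real (cos k) = c\<^sup>2 - d\<^sup>2" "complex_of_real (sin k) = 2 * d * c"
    by (simp_all add: c_def d_def)
  have xy: "x + \<i> * y = s * p" "x - \<i> * y = s * q" using s by (simp_all add: p_def q_def)
  have r: "rho (c - \<i> * d * z) (- \<i> * d * (x + \<i> * y)) =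
    vector [vector [(c - \<i> * d * z)\<^sup>2, - 2 * \<i> * d * q * (c - \<i> * d * z), - 2 * d\<^sup>2 * q\<^sup>2],
     vector [- 2 * \<i> * d * p * (c - \<i> * d * z), c\<^sup>2 + d\<^sup>2 * z\<^sup>2 - 2 * d\<^sup>2 * (p * q),
        - 2 * \<i> * d * q * (c + \<i> * d * z)],
     vector [- 2 * d\<^sup>2 * p\<^sup>2, - 2 * \<i> * d * p * (c + \<i> * d * z), (c + \<i> * d * z)\<^sup>2]]"
  proof -
    have cj: "cnj (c - \<i> * d * z) = c + \<i> * d * z" "cnj (- \<i> * d * (x + \<i> * y)) = \<i> * d * (s * q)"
      unfolding xy(2)[symmetric] by (simp_all add: c_def d_def x_def y_def z_def)
    have s2: "s * (s * w) = 2 * w" "s\<^sup>2 = 2" for w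
      using s(1) by (simp_all add: power2_eq_square flip: mult.assoc)
    show ?thesis
      unfolding rho_def cj unfolding xy(1) s_def[symmetric]
      by (simp add: vec_eq_iff forall_3 power_mult_distrib s2 mult_ac)
        (simp add: s s2 power2_eq_square algebra_simps)
  qed
  have cc: "c * c = 1 - d * d" "c * (c * w) = w - d * (d * w)" for w
  proof -
    show "c * c = 1 - d * d" using cd by (simp add: algebra_simps power2_eq_square)
    then show "c * (c * w) = w - d * (d * w)" by (simp add: left_diff_distrib flip: mult.assoc)
  qed
  show "(\<chi> i j. (mat 1 :: cmat) $ i $ j - \<i> * of_real (sin k) * gen u $ i $ j
            + (of_real (cos k) - 1) * (gen u ** gen u) $ i $ j)
      = rho (of_real (cos (k/2)) - \<i> * of_real (sin (k/2)) * of_real (u $ 3))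
            (- \<i> * of_real (sin (k/2)) * (of_real (u $ 1) + \<i> * of_real (u $ 2)))"
    unfolding k g2 c_def[symmetric] d_def[symmetric] x_def[symmetric] y_def[symmetric] z_def[symmetric] r
    unfolding g
    by (simp add: vec_eq_iff forall_3 mat_def,
        simp add: algebra_simps power2_eq_square, simp add: zz cc algebra_simps)
qed

text \<open>Splitting off the length \<open>r\<close> covers every direction, the zero vector being
  \<open>r = 0\<close> with any unit \<open>u\<close>.\<close>

lemma mexp_gen:
  assumes "norm u = 1"
  shows "mexp (csmult (- \<i> * of_real t) (gen (r *\<^sub>R u))) =
    rho (of_real (cos (t*r/2)) - \<i> * of_real (sin (t*r/2)) * of_real (u $ 3))
        (- \<i> * of_real (sin (t*r/2)) * (of_real (u $ 1) + \<i> * of_real (u $ 2)))"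
proof -
  have "csmult (- \<i> * of_real t) (gen (r *\<^sub>R u)) = csmult (- \<i> * of_real (t * r)) (gen u)"
    unfolding gen_scaleR by (simp add: csmult_def mult_ac)
  then show ?thesis using mexp_cubic[OF gen_unit_cubic(1)[OF assms], of "t*r"] gen_unit_cubic(2)[OF assms, of "t*r"]
    by simp
qed

lemma Zrot_eq: "Zrot \<alpha> \<beta> \<gamma> =
  rho (of_real (cos (\<beta>/2)) * cis (- (\<alpha> + \<gamma>) / 2)) (of_real (sin (\<beta>/2)) * cis ((\<alpha> - \<gamma>) / 2))"
proof -
  have z: "mexp (csmult (- \<i> * of_real t) Jz) = rho (cis (- t / 2)) 0" for t
  proof -
    have "Jz = gen (1 *\<^sub>R axis 3 1)"
      by (simp add: gen_def csmult_def vec_eq_iff axis_def)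
    moreover have "complex_of_real (cos (t/2)) - \<i> * of_real (sin (t/2)) = cis (-t/2)"
      by (simp add: complex_eq_iff)
    ultimately show ?thesis using mexp_gen[of "axis 3 1" t 1, OF norm_axis_1] by (simp add: axis_def)
  qed
  have y: "mexp (csmult (- \<i> * of_real t) Jy) = rho (of_real (cos (t/2))) (of_real (sin (t/2)))" for t
  proof -
    have "Jy = gen (1 *\<^sub>R axis 2 1)"
      by (simp add: gen_def csmult_def vec_eq_iff axis_def)
    moreover have "- (\<i> * w * \<i>) = w" for w by (simp add: mult.commute)
    ultimately show ?thesis using mexp_gen[of "axis 2 1" t 1, OF norm_axis_1] by (simp add: axis_def)
  qed
  have c: "cis (- \<alpha>/2) * of_real (cos (\<beta>/2)) * cis (- \<gamma>/2) = of_real (cos (\<beta>/2)) * cis (- (\<alpha> + \<gamma>) / 2)"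
    "cis (\<alpha>/2) * of_real (sin (\<beta>/2)) * cis (- \<gamma>/2) = of_real (sin (\<beta>/2)) * cis ((\<alpha> - \<gamma>) / 2)"
    by (simp_all add: cis_mult mult_ac) (simp_all add: field_simps)
  have "Zrot \<alpha> \<beta> \<gamma> = rho (cis (- \<alpha>/2) * of_real (cos (\<beta>/2)) * cis (- \<gamma>/2))
      (cis (\<alpha>/2) * of_real (sin (\<beta>/2)) * cis (- \<gamma>/2))"
    unfolding Zrot_def z y rho_mult by (simp add: cis_cnj)
  then show ?thesis unfolding c .
qed

text \<open>Polar forms of \<open>a\<close> and \<open>b\<close> with moduli
  \<open>cos \<theta>\<close> and \<open>sin \<theta>\<close> can be solved for the Euler angles, so
  the angles reach the image of all of SU(2).\<close>

lemma Rgrp_eq: "Rgrp = {rho a b | a b. (cmod a)\<^sup>2 + (cmod b)\<^sup>2 = 1}"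
proof (intro equalityI subsetI)
  fix U assume "U \<in> Rgrp"
  then show "U \<in> {rho a b | a b. (cmod a)\<^sup>2 + (cmod b)\<^sup>2 = 1}"
    by (force simp: Rgrp_def Zrot_eq norm_mult)
next
  fix U assume "U \<in> {rho a b | a b. (cmod a)\<^sup>2 + (cmod b)\<^sup>2 = 1}"
  then obtain a b where U: "U = rho a b" and ab: "(cmod a)\<^sup>2 + (cmod b)\<^sup>2 = 1" by blast
  obtain \<theta> where \<theta>: "cmod a = cos \<theta>" "cmod b = sin \<theta>"
    using sincos_total_pi_half[OF norm_ge_zero norm_ge_zero ab] by blast
  have "U = Zrot (Arg b - Arg a) (2 * \<theta>) (- Arg a - Arg b)"
    using rcis_cmod_Arg[of a] rcis_cmod_Arg[of b]
    unfolding U Zrot_eq rcis_def \<theta> by (simp add: algebra_simps)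
  then show "U \<in> Rgrp" unfolding Rgrp_def by blast
qed

subsection \<open>The objective function in Euler angles\<close>

text \<open>The measurement only removes the coherence between the first basis vector and the other
  two, so \<open>P\<close> is a sum of two squared moduli: the amplitude through the first vector
  and that through its complement. Leaving them under \<open>Re\<close> keeps a polynomial in the
  parameters and their conjugates.\<close>

lemma Pfun_rho: "Pfun (rho a b) (rho c d) =
  Re (2 * (c * d * cnj c * cnj d) * (a * cnj a)\<^sup>2 +
      (of_real (sqrt 2) * (a * b * (c * cnj c - d * cnj d) - cnj c * cnj d * b\<^sup>2)) *
      cnj (of_real (sqrt 2) * (a * b * (c * cnj c - d * cnj d) - cnj c * cnj d * b\<^sup>2)))"
proof -
  define U where "U = rho a b"
  define V where "V = rho c d"
  have 1: "U ** proj 1 ** adj U = (\<chi> i j. U $ i $ 1 * cnj (U $ j $ 1))"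
    by (simp add: vec_eq_iff forall_3 proj_def adj_def matrix_matrix_mult_def sum_3)
  have 2: "Mmeas 1 (\<chi> i j. u i * cnj (u j)) =
      (\<chi> i j. if (i = 1) = (j = 1) then u i * cnj (u j) else 0)" for u
    by (simp add: Mmeas_def vec_eq_iff forall_3 proj_def mat_def matrix_matrix_mult_def sum_3)
  have 3: "(V ** (\<chi> i j. if (i = 1) = (j = 1) then u i * cnj (u j) else 0) ** adj V) $ 2 $ 2
      = (V$2$1 * u 1) * cnj (V$2$1 * u 1) + (V$2$2 * u 2 + V$2$3 * u 3) * cnj (V$2$2 * u 2 + V$2$3 * u 3)" for u
    by (simp add: adj_def matrix_matrix_mult_def sum_3 algebra_simps)
  have r: "V$2$1 * U$1$1 = of_real (sqrt 2) * (c * d * a\<^sup>2)"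
    "V$2$2 * U$2$1 + V$2$3 * U$3$1 = of_real (sqrt 2) * (a * b * (c * cnj c - d * cnj d) - cnj c * cnj d * b\<^sup>2)"
    by (simp_all add: U_def V_def rho_def algebra_simps)
  have s: "(of_real (sqrt 2) * (c * d * a\<^sup>2)) * cnj (of_real (sqrt 2) * (c * d * a\<^sup>2))
    = 2 * (c * d * cnj c * cnj d) * (a * cnj a)\<^sup>2"
    by (simp add: power_mult_distrib mult_ac sqrt2_sq)
  show ?thesis
    unfolding Pfun_def U_def[symmetric] V_def[symmetric] 1 2 3 r s ..
qed

text \<open>Here \<open>\<beta>\<close> and \<open>\<eta>\<close> are the middle Euler angles of
  \<open>U1\<close> and \<open>U2\<close>. The numerator is the quadratic form in
  \<open>(cos \<eta>, sin \<eta>)\<close> with diagonal entries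
  \<open>2 * (sin \<beta>)\<^sup>2\<close>, \<open>1 + (cos \<beta>)\<^sup>2\<close> and
  off-diagonal entry \<open>- sin \<beta> * (1 - cos \<beta>) * cos \<phi>\<close>.\<close>

definition effP :: "real \<Rightarrow> real \<Rightarrow> real \<Rightarrow> real" where
  "effP \<phi> \<beta> \<eta> = ((sin \<eta>)\<^sup>2 * (1 + (cos \<beta>)\<^sup>2) + 2 * (cos \<eta>)\<^sup>2 * (sin \<beta>)\<^sup>2
     - 2 * (cos \<eta> * sin \<eta> * sin \<beta> * (1 - cos \<beta>)) * cos \<phi>) / 4"

text \<open>In the amplitude through the complement, \<open>\<gamma>\<close> is a global phase and
  \<open>\<alpha>'\<close> cancels; only the relative phase \<open>\<alpha> + \<gamma>'\<close> of
  its two summands survives.\<close>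

lemma Pfun_Zrot: "Pfun (Zrot \<alpha> \<beta> \<gamma>) (Zrot \<alpha>' \<beta>' \<gamma>') = effP (\<alpha> + \<gamma>') \<beta> \<beta>'"
proof -
  define x y u v where "x = cos (\<beta>/2)" and "y = sin (\<beta>/2)" and "u = cos (\<beta>'/2)" and "v = sin (\<beta>'/2)"
  define p q where "p = cis (- (\<alpha> + \<gamma>) / 2)" and "q = cis ((\<alpha> - \<gamma>) / 2)"
  define r s where "r = cis (- (\<alpha>' + \<gamma>') / 2)" and "s = cis ((\<alpha>' - \<gamma>') / 2)"
  have cc: "p * cnj p = 1" "q * cnj q = 1" "r * cnj r = 1" "s * cnj s = 1"
    by (simp_all add: p_def q_def r_def s_def cis_cnj cis_mult)
  have e: "(\<alpha> * 4 + \<gamma>' * 4 - \<gamma> * 4) / 4 = \<alpha> + \<gamma>' - \<gamma>"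
    by simp
  have c': "of_real x * p * (of_real y * q) = of_real (x * y) * cis (- \<gamma>)"
    "cnj (of_real u * r) * cnj (of_real v * s) * (of_real y * q)\<^sup>2 =
      of_real (u * v * y\<^sup>2) * (cis (- \<gamma>) * cis (\<alpha> + \<gamma>'))"
    by (simp_all add: p_def q_def r_def s_def cis_cnj cis_mult power_mult_distrib power2_eq_square)
      (simp_all add: field_simps e)
  have sq: "Re ((of_real (sqrt 2) * (cis \<theta> * z)) * cnj (of_real (sqrt 2) * (cis \<theta> * z))) = 2 * (cmod z)\<^sup>2" for \<theta> z
    unfolding complex_norm_square[symmetric] by (simp add: norm_mult power_mult_distrib)
  have id: "u\<^sup>2 + v\<^sup>2 = 1" "x\<^sup>2 + y\<^sup>2 = 1" by (simp_all add: x_def y_def u_def v_def)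
  have cb: "cos \<beta> = x\<^sup>2 - y\<^sup>2" "sin \<beta> = 2 * x * y" "cos \<beta>' = u\<^sup>2 - v\<^sup>2" "sin \<beta>' = 2 * u * v"
    using cos_double[of "\<beta>/2"] sin_double[of "\<beta>/2"] cos_double[of "\<beta>'/2"] sin_double[of "\<beta>'/2"]
    by (simp_all add: x_def y_def u_def v_def)
  define a b c d where "a = of_real x * p" and "b = of_real y * q" and "c = of_real u * r" and "d = of_real v * s"
  have aa: "a * cnj a = of_real (x\<^sup>2)" "c * cnj c = of_real (u\<^sup>2)" "d * cnj d = of_real (v\<^sup>2)"
    using cc by (simp_all add: a_def c_def d_def power2_eq_square mult_ac)
  have "Pfun (Zrot \<alpha> \<beta> \<gamma>) (Zrot \<alpha>' \<beta>' \<gamma>') = Pfun (rho a b) (rho c d)"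
    unfolding Zrot_eq a_def b_def c_def d_def p_def q_def r_def s_def x_def y_def u_def v_def ..
  also have "\<dots> = Re (2 * of_real (u\<^sup>2 * v\<^sup>2) * (of_real (x\<^sup>2))\<^sup>2 +
     (of_real (sqrt 2) * (cis (- \<gamma>) * (of_real (x * y * (u\<^sup>2 - v\<^sup>2)) - of_real (u * v * y\<^sup>2) * cis (\<alpha> + \<gamma>')))) *
     cnj (of_real (sqrt 2) * (cis (- \<gamma>) * (of_real (x * y * (u\<^sup>2 - v\<^sup>2)) - of_real (u * v * y\<^sup>2) * cis (\<alpha> + \<gamma>')))))"
  proof -
    have "c * d * cnj c * cnj d = (c * cnj c) * (d * cnj d)" by (simp add: mult_ac)
    moreover have "a * b * (c * cnj c - d * cnj d) - cnj c * cnj d * b\<^sup>2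
      = cis (- \<gamma>) * (of_real (x * y * (u\<^sup>2 - v\<^sup>2)) - of_real (u * v * y\<^sup>2) * cis (\<alpha> + \<gamma>'))"
      unfolding aa unfolding a_def b_def c_def d_def c' by (simp add: algebra_simps)
    ultimately show ?thesis unfolding Pfun_rho aa by simp
  qed
  also have "\<dots> = 2 * (u\<^sup>2 * v\<^sup>2) * (x\<^sup>2)\<^sup>2 +
     2 * ((x * y * (u\<^sup>2 - v\<^sup>2) - u * v * y\<^sup>2 * cos (\<alpha> + \<gamma>'))\<^sup>2 + (u * v * y\<^sup>2 * sin (\<alpha> + \<gamma>'))\<^sup>2)"
    unfolding plus_complex.sel sq by (simp add: cmod_power2)
  also have "\<dots> = 2 * (u\<^sup>2 * v\<^sup>2) * (x\<^sup>2)\<^sup>2 +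
     2 * ((x * y * (u\<^sup>2 - v\<^sup>2))\<^sup>2 + (u * v * y\<^sup>2)\<^sup>2 - 2 * (x * y * (u\<^sup>2 - v\<^sup>2)) * (u * v * y\<^sup>2) * cos (\<alpha> + \<gamma>'))"
    using sin_cos_squared_add[of "\<alpha> + \<gamma>'"] by algebra
  also have "\<dots> = effP (\<alpha> + \<gamma>') \<beta> \<beta>'"
    unfolding effP_def cb using id by algebra
  finally show ?thesis .
qed

subsection \<open>Local minima\<close>

text \<open>If \<open>l\<close> were negative, \<open>h1\<close> would be negative just to the right
  of \<open>x\<close>, and the mean value theorem would make \<open>h\<close> drop below
  \<open>h x\<close>.\<close>

lemma local_min_deriv2:
  fixes h h1 :: "real \<Rightarrow> real"
  assumes h: "\<And>t. (h has_real_derivative h1 t) (at t)"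
    and h1: "(h1 has_real_derivative l) (at x)"
    and e: "e > 0" "\<And>t. \<bar>t - x\<bar> < e \<Longrightarrow> h x \<le> h t"
  shows "h1 x = 0" "l \<ge> 0"
proof -
  show 0: "h1 x = 0"
    by (rule DERIV_local_min[OF h e(1)]) (use e(2) in \<open>auto simp: abs_minus_commute\<close>)
  show "l \<ge> 0"
  proof (rule ccontr)
    assume "\<not> l \<ge> 0"
    then obtain d where d: "d > 0" "\<And>t. 0 < t \<Longrightarrow> t < d \<Longrightarrow> h1 (x + t) < 0"
      using DERIV_neg_dec_right[OF h1] 0 by force
    \<comment> \<open>Below \<open>d\<close>, so that \<open>h1\<close> is negative at the mean
      value point, and below \<open>e\<close>, so that minimality applies at
      \<open>x + m\<close>.\<close>
    define m where "m = min d e / 2"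
    have m: "0 < m" "m < d" "m < e" using d(1) e(1) by (auto simp: m_def)
    obtain z where z: "x < z" "z < x + m" "h (x + m) - h x = (x + m - x) * h1 z"
      using MVT2[of x "x + m" h h1] h m(1) by auto
    have "h1 z < 0" using d(2)[of "z - x"] z m by simp
    then have "m * h1 z < 0" using m(1) by (simp add: mult_pos_neg)
    then have "h (x + m) < h x" using z(3) by simp
    then show False using e(2)[of "x + m"] m by simp
  qed
qed

text \<open>A critical point of the form on the unit circle is an eigenvector with eigenvalue
  \<open>\<mu>\<close>. By the trace, \<open>2 * \<mu> - A - B\<close> is the gap to the other
  eigenvalue, and \<open>\<mu>\<close> minus the matrix is this gap times the projection onto
  \<open>(w, - y)\<close>.\<close>

lemma quadratic_form_critical:
  fixes A B C y w \<mu> :: real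
  assumes yw: "y\<^sup>2 + w\<^sup>2 = 1"
    and \<mu>: "\<mu> = A * y\<^sup>2 + 2 * C * (y * w) + B * w\<^sup>2"
    and crit: "y * w * (B - A) + (y\<^sup>2 - w\<^sup>2) * C = 0"
  shows "\<mu> - A = (2 * \<mu> - A - B) * w\<^sup>2" "\<mu> - B = (2 * \<mu> - A - B) * y\<^sup>2"
    "C = (2 * \<mu> - A - B) * (y * w)"
proof -
  have e: "(\<mu> - A) * y = C * w" "(\<mu> - B) * w = C * y"
    unfolding \<mu> using yw crit by algebra+
  show "\<mu> - A = (2 * \<mu> - A - B) * w\<^sup>2" "\<mu> - B = (2 * \<mu> - A - B) * y\<^sup>2"
    "C = (2 * \<mu> - A - B) * (y * w)"
    using e yw by algebra+
qed

text \<open>Each angle is varied alone: first-order conditions in all three, second-order ones in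
  \<open>\<eta>\<close> and \<open>\<beta>\<close>, no mixed derivatives.\<close>

lemma effP_at_local_min:
  assumes e: "e > 0"
    and min: "\<And>\<phi>' \<beta>' \<eta>'. \<bar>\<phi>' - \<phi>\<bar> < e \<Longrightarrow> \<bar>\<beta>' - \<beta>\<bar> < e \<Longrightarrow> \<bar>\<eta>' - \<eta>\<bar> < e \<Longrightarrow>
       effP \<phi> \<beta> \<eta> \<le> effP \<phi>' \<beta>' \<eta>'"
  shows "effP \<phi> \<beta> \<eta> = 0"
proof -
  define x s y w k where "x = cos \<beta>" and "s = sin \<beta>" and "y = cos \<eta>" and "w = sin \<eta>" and "k = cos \<phi>"
  note defs = x_def s_def y_def w_def k_def
  have xs: "x\<^sup>2 + s\<^sup>2 = 1" and yw: "y\<^sup>2 + w\<^sup>2 = 1" by (simp_all add: defs)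
  define D\<eta> where "D\<eta> \<phi> \<eta> = (cos \<eta> * sin \<eta> * (1 + x\<^sup>2) - 2 * cos \<eta> * sin \<eta> * s\<^sup>2
     - ((cos \<eta>)\<^sup>2 - (sin \<eta>)\<^sup>2) * s * (1 - x) * cos \<phi>) / 2" for \<phi> \<eta>
  have D\<eta>: "((effP \<phi> \<beta>) has_real_derivative D\<eta> \<phi> \<eta>) (at \<eta>)" for \<phi> \<eta>
    unfolding effP_def[abs_def] D\<eta>_def x_def s_def
    by (auto intro!: derivative_eq_intros simp: field_simps power2_eq_square)
  have DD\<eta>: "(D\<eta> \<phi> has_real_derivative ((y\<^sup>2 - w\<^sup>2) * (1 + x\<^sup>2) - 2 * (y\<^sup>2 - w\<^sup>2) * s\<^sup>2
      + 4 * y * w * s * (1 - x) * k) / 2) (at \<eta>)"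
    unfolding D\<eta>_def[abs_def] y_def w_def k_def
    by (auto intro!: derivative_eq_intros simp: field_simps power2_eq_square)
  note \<eta>0 = local_min_deriv2[OF D\<eta> DD\<eta> e min[of \<phi> \<beta>]]
  have \<eta>1: "y * w * (1 + x\<^sup>2) - 2 * y * w * s\<^sup>2 - (y\<^sup>2 - w\<^sup>2) * s * (1 - x) * k = 0"
    using \<eta>0(1) e by (simp add: D\<eta>_def defs)
  have \<eta>2: "(y\<^sup>2 - w\<^sup>2) * (1 + x\<^sup>2) - 2 * (y\<^sup>2 - w\<^sup>2) * s\<^sup>2 + 4 * y * w * s * (1 - x) * k \<ge> 0"
    using \<eta>0(2) e by simp
  define D\<beta> where "D\<beta> \<beta> = (2 * y\<^sup>2 * sin \<beta> * cos \<beta> - w\<^sup>2 * sin \<beta> * cos \<beta>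
      - y * w * k * (cos \<beta> * (1 - cos \<beta>) + (sin \<beta>)\<^sup>2)) / 2" for \<beta>
  have D\<beta>: "((\<lambda>\<beta>. effP \<phi> \<beta> \<eta>) has_real_derivative D\<beta> \<beta>) (at \<beta>)" for \<beta>
    unfolding effP_def[abs_def] D\<beta>_def y_def w_def k_def
    by (auto intro!: derivative_eq_intros simp: field_simps power2_eq_square)
  have DD\<beta>: "(D\<beta> has_real_derivative (2 * y\<^sup>2 * (x\<^sup>2 - s\<^sup>2) - w\<^sup>2 * (x\<^sup>2 - s\<^sup>2)
      - y * w * k * s * (4 * x - 1)) / 2) (at \<beta>)"
    unfolding D\<beta>_def[abs_def] x_def s_def
    by (auto intro!: derivative_eq_intros simp: field_simps power2_eq_square)
  note \<beta>0 = local_min_deriv2[OF D\<beta> DD\<beta> e min[of \<phi> _ \<eta>]]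
  have \<beta>1: "2 * y\<^sup>2 * s * x - w\<^sup>2 * s * x - y * w * k * (x * (1 - x) + s\<^sup>2) = 0"
    using \<beta>0(1) e by (simp add: D\<beta>_def defs)
  have \<beta>2: "2 * y\<^sup>2 * (x\<^sup>2 - s\<^sup>2) - w\<^sup>2 * (x\<^sup>2 - s\<^sup>2) - y * w * k * s * (4 * x - 1) \<ge> 0"
    using \<beta>0(2) e by simp
  have D\<phi>: "((\<lambda>\<phi>. effP \<phi> \<beta> \<eta>) has_real_derivative y * w * s * (1 - x) * sin \<phi> / 2) (at \<phi>)" for \<phi>
    unfolding effP_def[abs_def] defs
    by (auto intro!: derivative_eq_intros simp: field_simps power2_eq_square)
  have \<phi>1: "y * w * s * (1 - x) * sin \<phi> = 0"
    using DERIV_local_min[OF D\<phi> e] min e by (simp add: abs_minus_commute)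
  show ?thesis
  proof (cases "s = 0")
    \<comment> \<open>The form is now diagonal with entries 0 and 2, so a minimum in
      \<open>\<eta>\<close> has \<open>w = 0\<close> and value 0.\<close>
    case True
    then have x2: "x\<^sup>2 = 1" using xs by simp
    have "y * w = 0" using \<eta>1 True x2 by simp
    moreover have "y\<^sup>2 \<ge> w\<^sup>2" using \<eta>2 True x2 by simp
    ultimately have "w = 0" using yw by auto
    then show ?thesis using True by (simp add: effP_def defs)
  next
    case s0: False
    then have x1: "-1 < x" "x < 1"
    proof -
      have "x\<^sup>2 < 1" using xs s0 by (smt (verit) zero_less_power2)
      then show "-1 < x" "x < 1" using abs_square_less_1[of x] by auto
    qed
    have yw0: "y * w \<noteq> 0"
    proof
      \<comment> \<open>Then \<open>effP\<close> is constant in \<open>\<phi>\<close> here, so all nearby \<open>\<phi>'\<close> give local minima in \<open>\<eta>\<close>.\<close>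
      assume 0: "y * w = 0"
      have cos0: "cos \<phi>' = 0" if \<phi>': "\<bar>\<phi>' - \<phi>\<bar> < e" for \<phi>'
      proof -
        have eq: "effP \<phi>' \<beta> \<eta> = effP \<phi> \<beta> \<eta>"
          using 0 by (auto simp: effP_def y_def w_def)
        have "D\<eta> \<phi>' \<eta> = 0"
          by (rule DERIV_local_min[OF D\<eta> e])
            (use min[OF \<phi>', of \<beta>] e eq in \<open>auto simp: abs_minus_commute\<close>)
        then have "(y\<^sup>2 - w\<^sup>2) * s * (1 - x) * cos \<phi>' = 0"
          using 0 by (auto simp: D\<eta>_def y_def w_def)
        moreover have "y\<^sup>2 - w\<^sup>2 \<noteq> 0" using 0 yw by auto
        ultimately show ?thesis using s0 x1 by simp
      qed
      \<comment> \<open>As \<open>cos\<close> vanishes on a whole neighbourhood,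
        \<open>\<phi>\<close> is a local minimum of \<open>cos\<close>, and the derivative
        \<open>- sin \<phi>\<close> vanishes too.\<close>
      have "sin \<phi> = 0"
        using DERIV_local_min[OF DERIV_cos[of \<phi>] e] cos0 e by (simp add: abs_minus_commute)
      then show False using cos0[of \<phi>] e sin_cos_squared_add[of \<phi>] by simp
    qed
    then have "sin \<phi> = 0" using \<phi>1 s0 x1 by simp
    then have k2: "k\<^sup>2 = 1" using sin_cos_squared_add[of \<phi>] by (simp add: k_def)
    define \<mu> where "\<mu> = 4 * effP \<phi> \<beta> \<eta>"
    have \<mu>: "\<mu> = w\<^sup>2 * (1 + x\<^sup>2) + 2 * y\<^sup>2 * s\<^sup>2 - 2 * y * w * s * (1 - x) * k"
      by (simp add: \<mu>_def effP_def defs)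
    define C where "C = - k * s * (1 - x)"
    \<comment> \<open>\<open>(y, w)\<close> is an eigenvector for \<open>\<mu>\<close>, and \<open>T\<close> is \<open>\<mu>\<close> minus the other eigenvalue.\<close>
    define T where "T = 2 * \<mu> - 2 * s\<^sup>2 - (1 + x\<^sup>2)"
    have T1: "\<mu> - 2 * s\<^sup>2 = T * w\<^sup>2" and T2: "\<mu> - (1 + x\<^sup>2) = T * y\<^sup>2" and T3: "C = T * (y * w)"
    proof -
      have q: "\<mu> = 2 * s\<^sup>2 * y\<^sup>2 + 2 * C * (y * w) + (1 + x\<^sup>2) * w\<^sup>2"
        by (simp add: \<mu> C_def)
      have "y * w * (1 + x\<^sup>2 - 2 * s\<^sup>2) + (y\<^sup>2 - w\<^sup>2) * C = 0"
        using \<eta>1 by (simp add: C_def algebra_simps)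
      from quadratic_form_critical[OF yw q this]
      show "\<mu> - 2 * s\<^sup>2 = T * w\<^sup>2" "\<mu> - (1 + x\<^sup>2) = T * y\<^sup>2" "C = T * (y * w)"
        by (simp_all only: T_def)
    qed
    have C0: "C \<noteq> 0" using s0 x1 k2 by (auto simp: C_def)
    have "T \<noteq> 0" using C0 T3 by auto
    \<comment> \<open>\<open>- T\<close> is the left-hand side of the second-order condition in
      \<open>\<eta>\<close>: a minimum belongs to the smaller eigenvalue.\<close>
    moreover have "T \<le> 0"
    proof -
      have "T = - ((y\<^sup>2 - w\<^sup>2) * (1 + x\<^sup>2) - 2 * (y\<^sup>2 - w\<^sup>2) * s\<^sup>2 + 4 * y * w * s * (1 - x) * k)"
        unfolding T_def \<mu> using yw by algebra
      then show ?thesis using \<eta>2 by simp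
    qed
    ultimately have T: "T < 0" by simp
    \<comment> \<open>The characteristic equation of the form.\<close>
    have F: "(\<mu> - 2 * s\<^sup>2) * (\<mu> - (1 + x\<^sup>2)) = C\<^sup>2"
      unfolding T1 T2 T3 by algebra
    have C2: "C\<^sup>2 = (1 - x\<^sup>2) * (1 - x)\<^sup>2"
      unfolding C_def using k2 xs by algebra
    have s2: "s\<^sup>2 = 1 - x\<^sup>2" using xs by simp
    have Ck: "C * k = - s * (1 - x)" unfolding C_def using k2 by algebra
    \<comment> \<open>Multiplying stationarity in \<open>\<beta>\<close> by \<open>T\<close>
      replaces all products of \<open>y\<close> and \<open>w\<close> by terms in
      \<open>\<mu>\<close>, \<open>x\<close>, \<open>s\<close>; dividing by \<open>s\<close> leaves
      a relation between \<open>x\<close> and \<open>\<mu>\<close>.\<close>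
    have F': "x * \<mu> = 2 * x ^ 3 + 3 * x\<^sup>2 - 1"
    proof -
      have "2 * (\<mu> - (1 + x\<^sup>2)) * s * x - (\<mu> - 2 * s\<^sup>2) * s * x - C * k * (x * (1 - x) + s\<^sup>2) = 0"
        unfolding T1 T2 T3 using \<beta>1 by algebra
      then have "s * (2 * (\<mu> - (1 + x\<^sup>2)) * x - (\<mu> - 2 * s\<^sup>2) * x + (1 - x) * (x * (1 - x) + s\<^sup>2)) = 0"
        unfolding Ck by algebra
      then have "2 * (\<mu> - (1 + x\<^sup>2)) * x - (\<mu> - 2 * s\<^sup>2) * x + (1 - x) * (x * (1 - x) + s\<^sup>2) = 0"
        using s0 by simp
      then show ?thesis unfolding s2 by (simp add: algebra_simps power2_eq_square power3_eq_cube)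
    qed
    \<comment> \<open>The second-order condition in \<open>\<beta>\<close>, treated the same way;
      the sign flips because \<open>T < 0\<close>.\<close>
    have G: "2 * (\<mu> - (1 + x\<^sup>2)) * (2 * x\<^sup>2 - 1) - (\<mu> - 2 * (1 - x\<^sup>2)) * (2 * x\<^sup>2 - 1)
        + (1 - x\<^sup>2) * (1 - x) * (4 * x - 1) \<le> 0"
    proof -
      have "T * (2 * y\<^sup>2 * (x\<^sup>2 - s\<^sup>2) - w\<^sup>2 * (x\<^sup>2 - s\<^sup>2) - y * w * k * s * (4 * x - 1)) \<le> 0"
        using T \<beta>2 by (simp add: mult_nonpos_nonneg)
      also have "T * (2 * y\<^sup>2 * (x\<^sup>2 - s\<^sup>2) - w\<^sup>2 * (x\<^sup>2 - s\<^sup>2) - y * w * k * s * (4 * x - 1))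
        = 2 * (\<mu> - (1 + x\<^sup>2)) * (x\<^sup>2 - s\<^sup>2) - (\<mu> - 2 * s\<^sup>2) * (x\<^sup>2 - s\<^sup>2) - C * k * s * (4 * x - 1)"
        unfolding T1 T2 T3 by algebra
      also have "\<dots> = 2 * (\<mu> - (1 + x\<^sup>2)) * (2 * x\<^sup>2 - 1) - (\<mu> - 2 * (1 - x\<^sup>2)) * (2 * x\<^sup>2 - 1)
        + (1 - x\<^sup>2) * (1 - x) * (4 * x - 1)"
        unfolding Ck using s2 by algebra
      finally show ?thesis .
    qed
    have x0: "x \<noteq> 0" using F' by auto
    \<comment> \<open>Multiplying \<open>F\<close> by \<open>x\<^sup>2\<close> and inserting
      \<open>F'\<close> eliminates \<open>\<mu>\<close>.\<close>
    have "(1 + x)\<^sup>2 * ((x\<^sup>2 + x - 1) * (5 * x\<^sup>2 - 2 * x - 1)) = 0"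
    proof -
      have "(x * \<mu> - 2 * x * (1 - x\<^sup>2)) * (x * \<mu> - x * (1 + x\<^sup>2)) = x\<^sup>2 * ((1 - x\<^sup>2) * (1 - x)\<^sup>2)"
        using F[unfolded C2 s2] by algebra
      then show ?thesis unfolding F' by algebra
    qed
    then have "x\<^sup>2 + x - 1 = 0 \<or> 5 * x\<^sup>2 - 2 * x - 1 = 0" using x1 by simp
    then have False
    proof
      assume q: "x\<^sup>2 + x - 1 = 0"
      have "x * (\<mu> - 1) = 0" using F' q by algebra
      then have \<mu>1: "\<mu> = 1" using x0 by simp
      have x2: "x\<^sup>2 = 1 - x" using q by simp
      have "2 * (\<mu> - (1 + x\<^sup>2)) * (2 * x\<^sup>2 - 1) - (\<mu> - 2 * (1 - x\<^sup>2)) * (2 * x\<^sup>2 - 1)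
        + (1 - x\<^sup>2) * (1 - x) * (4 * x - 1) = 4 * x - 2"
        unfolding \<mu>1 using x2 by algebra
      then have "x \<le> 1 / 2" using G by simp
      \<comment> \<open>With \<open>x\<^sup>2 = 1 - x\<close> this product equals
        \<open>(1 - x) / 2\<close>, which would force \<open>x \<ge> 1\<close>.\<close>
      then have "(x - 1 / 2) * (x + 1) \<le> 0" using x1 by (simp add: mult_nonpos_nonneg)
      then show False using x2 \<open>x \<le> 1 / 2\<close> by (simp add: algebra_simps power2_eq_square)
    next
      assume q: "5 * x\<^sup>2 - 2 * x - 1 = 0"
      \<comment> \<open>The smaller eigenvalue is at most half the trace
        \<open>3 - x\<^sup>2\<close>; with the value of \<open>\<mu>\<close> found below this would
        give \<open>x \<ge> 1\<close>.\<close>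
      have \<mu>le: "2 * \<mu> \<le> 3 - x\<^sup>2" using T s2 by (simp add: T_def)
      have "x * (5 * \<mu> - 12 + 6 * x) = 0" using F' q by algebra
      then have "5 * \<mu> = 12 - 6 * x" using x0 by simp
      moreover have "5 * x\<^sup>2 = 2 * x + 1" using q by simp
      ultimately show False using \<mu>le x1 by simp
    qed
    then show ?thesis ..
  qed
qed

subsection \<open>The global maximum\<close>

definition Pmax :: real where "Pmax = 3 / 50 * (9 + sqrt 6)"

text \<open>The left side is the determinant of \<open>4 * Pmax\<close> minus the form when
  \<open>cos \<phi>\<close> is 1 or -1. Its double root \<open>(1 - sqrt 6) / 5\<close> is a root of
  \<open>5 * x\<^sup>2 - 2 * x - 1\<close>, the factor met at local minima, and is where the bound
  is attained.\<close>

lemma Pmax_discriminant: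
  fixes x :: real
  shows "(4 * Pmax - 2 * (1 - x\<^sup>2)) * (4 * Pmax - (1 + x\<^sup>2)) - (1 - x\<^sup>2) * (1 - x)\<^sup>2
    = (x - (1 - sqrt 6) / 5)\<^sup>2 * ((13 + 32 * sqrt 6) / 25 - (12 - 2 * sqrt 6) / 5 * x - x\<^sup>2)"
proof -
  define r where "r = sqrt 6"
  have rr: "r * r = 6" "r * (r * z) = 6 * z" for z
    by (simp_all add: r_def flip: mult.assoc)
  show ?thesis unfolding Pmax_def r_def[symmetric]
    by (simp add: field_simps power2_eq_square rr)
qed

text \<open>\<open>\<mu>\<close> minus the form is positive semidefinite: its corner
  \<open>\<mu> - A\<close> is positive and its determinant is nonnegative.\<close>

lemma effP_le_Pmax: "effP \<phi> \<beta> \<eta> \<le> Pmax"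
proof -
  define x s y w k where "x = cos \<beta>" and "s = sin \<beta>" and "y = cos \<eta>" and "w = sin \<eta>" and "k = cos \<phi>"
  note defs = x_def s_def y_def w_def k_def
  have s2: "s\<^sup>2 = 1 - x\<^sup>2" and y2: "y\<^sup>2 + w\<^sup>2 = 1" and k2: "k\<^sup>2 \<le> 1"
    by (simp_all add: defs sin_squared_eq abs_square_le_1)
  have x: "-1 \<le> x" "x \<le> 1" by (simp_all add: defs)
  define \<mu> A B C where "\<mu> = 4 * Pmax" and "A = 2 * s\<^sup>2" and "B = 1 + x\<^sup>2" and "C = s * (1 - x) * k"
  have r: "2 \<le> sqrt 6" "sqrt 6 \<le> 3" by (auto intro: real_le_rsqrt real_le_lsqrt)
  have A: "\<mu> - A > 0"
  proof -
    have "\<mu> > 2" using r(1) by (simp add: \<mu>_def Pmax_def)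
    moreover have "A \<le> 2" by (simp add: A_def s2)
    ultimately show ?thesis by simp
  qed
  have "C\<^sup>2 \<le> (1 - x\<^sup>2) * (1 - x)\<^sup>2"
  proof -
    have "C\<^sup>2 = s\<^sup>2 * (1 - x)\<^sup>2 * k\<^sup>2" by (simp add: C_def power_mult_distrib)
    also have "\<dots> \<le> s\<^sup>2 * (1 - x)\<^sup>2" using k2 by (simp add: mult_left_le)
    finally show ?thesis by (simp add: s2)
  qed
  also have "\<dots> \<le> (\<mu> - A) * (\<mu> - B)"
  proof -
    \<comment> \<open>Bounding \<open>x\<close> and \<open>x\<^sup>2\<close> by 1 suffices, with the
      crude bounds \<open>r\<close> on \<open>sqrt 6\<close>.\<close>
    have "0 \<le> (13 + 32 * sqrt 6) / 25 - (12 - 2 * sqrt 6) / 5 * x - x\<^sup>2"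
    proof -
      have "(12 - 2 * sqrt 6) / 5 * x \<le> (12 - 2 * sqrt 6) / 5 * 1"
        using r(2) x by (intro mult_left_mono) auto
      moreover have "x\<^sup>2 \<le> 1" using x by (simp add: abs_square_le_1 abs_le_iff)
      ultimately show ?thesis using r by (simp add: field_simps)
    qed
    then have "0 \<le> (\<mu> - A) * (\<mu> - B) - (1 - x\<^sup>2) * (1 - x)\<^sup>2"
      unfolding \<mu>_def A_def B_def s2 Pmax_discriminant by simp
    then show ?thesis by simp
  qed
  finally have disc: "0 \<le> (\<mu> - A) * (\<mu> - B) - C\<^sup>2" by simp
  \<comment> \<open>Completing the square; \<open>C\<close> has the opposite sign to the
    off-diagonal entry of the form.\<close>
  have "(\<mu> - A) * (\<mu> - 4 * effP \<phi> \<beta> \<eta>) = ((\<mu> - A) * y + C * w)\<^sup>2 + ((\<mu> - A) * (\<mu> - B) - C\<^sup>2) * w\<^sup>2"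
  proof -
    have "4 * effP \<phi> \<beta> \<eta> = A * y\<^sup>2 - 2 * (C * (y * w)) + B * w\<^sup>2"
      by (simp add: effP_def A_def B_def C_def defs field_simps)
    then show ?thesis using y2 by algebra
  qed
  also have "\<dots> \<ge> 0" using disc by simp
  finally show ?thesis using A by (simp add: zero_le_mult_iff \<mu>_def)
qed

text \<open>At the double root of the discriminant, \<open>\<mu>\<close> is an eigenvalue of the
  form, and normalising the kernel vector \<open>(- C, \<mu> - A)\<close> gives
  \<open>\<eta>\<close>.\<close>

lemma effP_attains_Pmax: "\<exists>\<beta> \<eta>. effP 0 \<beta> \<eta> = Pmax"
proof -
  define x s where "x = (1 - sqrt 6) / 5" and "s = sqrt (1 - x\<^sup>2)"
  have r: "2 \<le> sqrt 6" "sqrt 6 \<le> 3" by (auto intro: real_le_rsqrt real_le_lsqrt)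
  then have x: "-1 < x" "x < 0" by (auto simp: x_def)
  then have x2: "x\<^sup>2 < 1" by (simp add: abs_square_less_1)
  then have s2: "s\<^sup>2 = 1 - x\<^sup>2" and s0: "s > 0" by (simp_all add: s_def)
  define \<mu> A B C where "\<mu> = 4 * Pmax" and "A = 2 * s\<^sup>2" and "B = 1 + x\<^sup>2" and "C = s * (1 - x)"
  have disc: "(\<mu> - A) * (\<mu> - B) = C\<^sup>2"
    using Pmax_discriminant[of x] unfolding \<mu>_def A_def B_def C_def power_mult_distrib s2
    by (simp add: x_def)
  have C0: "C > 0" using s0 x by (simp add: C_def)
  define n where "n = sqrt (C\<^sup>2 + (\<mu> - A)\<^sup>2)"
  have n2: "n\<^sup>2 = C\<^sup>2 + (\<mu> - A)\<^sup>2" by (simp add: n_def)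
  have n0: "n > 0" using C0 by (simp add: n_def sum_squares_gt_zero_iff add_pos_nonneg)
  define y w where "y = - C / n" and "w = (\<mu> - A) / n"
  have yw: "y\<^sup>2 + w\<^sup>2 = 1"
  proof -
    have "y\<^sup>2 + w\<^sup>2 = (C\<^sup>2 + (\<mu> - A)\<^sup>2) / n\<^sup>2"
      by (simp add: y_def w_def power_divide add_divide_distrib)
    then show ?thesis using n0 by (simp flip: n2)
  qed
  obtain \<eta> where \<eta>: "y = cos \<eta>" "w = sin \<eta>"
    using sincos_total_2pi[OF yw] by metis
  obtain \<beta> where \<beta>: "x = cos \<beta>" "s = sin \<beta>"
    using sincos_total_2pi[of x s] s2 by (metis add.commute diff_add_cancel)
  have ny: "n * y = - C" "n * w = \<mu> - A" using n0 by (simp_all add: y_def w_def)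
  have "4 * effP 0 \<beta> \<eta> = A * y\<^sup>2 - 2 * (C * (y * w)) + B * w\<^sup>2"
    by (simp add: effP_def A_def B_def C_def \<beta> \<eta> field_simps)
  then have "n\<^sup>2 * (4 * effP 0 \<beta> \<eta>) = A * (n * y)\<^sup>2 - 2 * (C * ((n * y) * (n * w))) + B * (n * w)\<^sup>2"
    by algebra
  also have "\<dots> = \<mu> * (C\<^sup>2 + (\<mu> - A)\<^sup>2)"
    unfolding ny using disc by algebra
  finally have "n\<^sup>2 * (4 * effP 0 \<beta> \<eta>) = n\<^sup>2 * \<mu>" by (simp add: n2)
  then have "effP 0 \<beta> \<eta> = Pmax" using n0 by (simp add: \<mu>_def)
  then show ?thesis by blast
qed

lemma global_max_imp_Pmax:
  assumes "global_max U1 U2" "U1 \<in> Rgrp" "U2 \<in> Rgrp"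
  shows "Pfun U1 U2 = Pmax"
proof (rule antisym)
  show "Pfun U1 U2 \<le> Pmax" using assms(2,3) effP_le_Pmax by (auto simp: Rgrp_def Pfun_Zrot)
  obtain \<beta> \<eta> where "effP 0 \<beta> \<eta> = Pmax" using effP_attains_Pmax by blast
  then have "Pfun (Zrot 0 \<beta> 0) (Zrot 0 \<eta> 0) = Pmax" by (simp add: Pfun_Zrot)
  moreover have "Zrot a b c \<in> Rgrp" for a b c by (auto simp: Rgrp_def)
  ultimately show "Pmax \<le> Pfun U1 U2" using assms(1) by (metis global_max_def)
qed

subsection \<open>Local extrema on the group\<close>

lemma continuous_on_rho [continuous_intros]:
  assumes "continuous_on S f" "continuous_on S g"
  shows "continuous_on S (\<lambda>t. rho (f t) (g t))"
proof -
  have e: "rho a b = (\<chi> i j. rho a b $ i $ j)" for a b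
    by (simp add: vec_eq_iff)
  have "\<forall>i j. continuous_on S (\<lambda>t. rho (f t) (g t) $ i $ j)"
    by (simp add: forall_3 rho_def) (intro conjI continuous_intros assms)
  then show ?thesis
    by (subst e) (intro continuous_on_vec_lambda, blast)
qed

lemma Zrot_in_Rgrp: "Zrot \<alpha> \<beta> \<gamma> \<in> Rgrp"
  by (auto simp: Rgrp_def)

text \<open>A neighbourhood in the group pulls back, along the continuous Euler angle map, to a box
  on which \<open>effP_at_local_min\<close> applies.\<close>

lemma Pfun_local_min:
  assumes "local_min U1 U2" "U1 \<in> Rgrp" "U2 \<in> Rgrp"
  shows "Pfun U1 U2 = 0"
proof -
  obtain a b c where U1: "U1 = Zrot a b c" using assms(2) by (auto simp: Rgrp_def)
  obtain a' b' c' where U2: "U2 = Zrot a' b' c'" using assms(3) by (auto simp: Rgrp_def)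
  obtain e where e: "e > 0"
    "\<And>V1 V2. V1 \<in> Rgrp \<Longrightarrow> V2 \<in> Rgrp \<Longrightarrow> dist (V1, V2) (U1, U2) < e \<Longrightarrow> Pfun U1 U2 \<le> Pfun V1 V2"
    using assms(1) unfolding local_min_def by blast
  \<comment> \<open>The phase is moved through the first angle of \<open>U1\<close> alone; the shift
    by \<open>c'\<close> makes the relevant sum equal to \<open>fst p\<close>.\<close>
  define \<Phi> where "\<Phi> p = (Zrot (fst p - c') (fst (snd p)) c, Zrot a' (snd (snd p)) c')" for p :: "real \<times> real \<times> real"
  have "continuous_on UNIV \<Phi>"
    unfolding \<Phi>_def Zrot_eq by (intro continuous_intros) auto
  then obtain d where d: "d > 0" "\<And>p. dist p (a + c', b, b') < d \<Longrightarrow> dist (\<Phi> p) (\<Phi> (a + c', b, b')) < e"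
    using e(1) unfolding continuous_on_iff by (meson UNIV_I)
  have \<Phi>0: "\<Phi> (a + c', b, b') = (U1, U2)" by (simp add: \<Phi>_def U1 U2)
  have "effP (a + c') b b' = 0"
  \<comment> \<open>The distance of triples is at most the sum of the three coordinate
    distances.\<close>
  proof (rule effP_at_local_min[of "d / 3"])
    show "d / 3 > 0" using d(1) by simp
    fix \<phi> \<beta> \<eta> assume near: "\<bar>\<phi> - (a + c')\<bar> < d / 3" "\<bar>\<beta> - b\<bar> < d / 3" "\<bar>\<eta> - b'\<bar> < d / 3"
    have "dist (\<phi>, \<beta>, \<eta>) (a + c', b, b') \<le> \<bar>\<phi> - (a + c')\<bar> + (\<bar>\<beta> - b\<bar> + \<bar>\<eta> - b'\<bar>)"
    proof -
      have "dist (\<beta>, \<eta>) (b, b') \<le> \<bar>\<beta> - b\<bar> + \<bar>\<eta> - b'\<bar>"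
        unfolding dist_Pair_Pair using sqrt_sum_squares_le_sum_abs[of "dist \<beta> b" "dist \<eta> b'"]
        by (simp add: dist_real_def)
      moreover have "dist (\<phi>, \<beta>, \<eta>) (a + c', b, b') \<le> \<bar>\<phi> - (a + c')\<bar> + dist (\<beta>, \<eta>) (b, b')"
        unfolding dist_Pair_Pair[of \<phi>]
        using sqrt_sum_squares_le_sum_abs[of "dist \<phi> (a + c')" "dist (\<beta>, \<eta>) (b, b')"]
        by (simp add: dist_real_def)
      ultimately show ?thesis by simp
    qed
    then have "dist (\<Phi> (\<phi>, \<beta>, \<eta>)) (U1, U2) < e"
      using d(2)[of "(\<phi>, \<beta>, \<eta>)"] near \<Phi>0 by simp
    then have "Pfun U1 U2 \<le> Pfun (Zrot (\<phi> - c') \<beta> c) (Zrot a' \<eta> c')"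
      by (intro e(2) Zrot_in_Rgrp) (simp add: \<Phi>_def)
    then show "effP (a + c') b b' \<le> effP \<phi> \<beta> \<eta>"
      by (simp add: U1 U2 Pfun_Zrot)
  qed
  then show ?thesis by (simp add: U1 U2 Pfun_Zrot)
qed

text \<open>A sum of squared moduli. Hence the value 0 at a local minimum makes it a global
  one.\<close>

lemma Pfun_nonneg: "V1 \<in> Rgrp \<Longrightarrow> V2 \<in> Rgrp \<Longrightarrow> 0 \<le> Pfun V1 V2"
proof -
  have "0 \<le> Pfun (rho a b) (rho c d)" for a b c d
  proof -
    have "c * d * cnj c * cnj d = (c * d) * cnj (c * d)" by (simp add: mult_ac)
    moreover have "2 * of_real x * (of_real y)\<^sup>2 + of_real z = complex_of_real (2 * x * y\<^sup>2 + z)" for x y z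
      by simp
    ultimately show ?thesis
      unfolding Pfun_rho complex_norm_square[symmetric] by (simp only: complex_norm_square[symmetric] Re_complex_of_real) simp
  qed
  then show "V1 \<in> Rgrp \<Longrightarrow> V2 \<in> Rgrp \<Longrightarrow> 0 \<le> Pfun V1 V2" unfolding Rgrp_eq by blast
qed

text \<open>Derivatives exist at every \<open>t\<close>, as the iterated \<open>deriv\<close> in
  \<open>hess\<close> requires. The class is closed under products and conjugation, hence contains
  the complex polynomial under \<open>Re\<close> in \<open>Pfun_rho\<close>.\<close>

definition twice_diff :: "(real \<Rightarrow> complex) \<Rightarrow> bool" where
  "twice_diff f \<longleftrightarrow> (\<exists>f' f''. \<forall>t. (f has_vector_derivative f' t) (at t) \<and>
     (f' has_vector_derivative f'' t) (at t))"

section \<open>Closure rules for twice differentiable functions\<close>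

lemma twice_diffI:
  assumes "\<And>t. (f has_vector_derivative f' t) (at t)"
    and "\<And>t. (f' has_vector_derivative f'' t) (at t)"
  shows "twice_diff f"
  unfolding twice_diff_def by (intro exI[of _ f'] exI[of _ f''] allI conjI assms)

lemma twice_diffE:
  assumes "twice_diff f"
  obtains f' f'' where "\<And>t. (f has_vector_derivative f' t) (at t)"
    "\<And>t. (f' has_vector_derivative f'' t) (at t)"
  using assms unfolding twice_diff_def by blast

lemma twice_diff_const: "twice_diff (\<lambda>t. c)"
  by (rule twice_diffI) (rule has_vector_derivative_const)+

lemma twice_diff_add:
  assumes "twice_diff f" "twice_diff g"
  shows "twice_diff (\<lambda>t. f t + g t)"
  by (rule twice_diffE[OF assms(1)], rule twice_diffE[OF assms(2)], rule twice_diffI)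
    (rule has_vector_derivative_add; assumption)+

lemma twice_diff_mult:
  assumes "twice_diff f" "twice_diff g"
  shows "twice_diff (\<lambda>t. f t * g t)"
  by (rule twice_diffE[OF assms(1)], rule twice_diffE[OF assms(2)], rule twice_diffI)
    (rule has_vector_derivative_add has_vector_derivative_mult | assumption)+

lemma twice_diff_cnj:
  assumes "twice_diff f"
  shows "twice_diff (\<lambda>t. cnj (f t))"
  by (rule twice_diffE[OF assms], rule twice_diffI)
    (rule bounded_linear.has_vector_derivative[OF bounded_linear_cnj]; assumption)+

lemma twice_diff_diff:
  assumes "twice_diff f" "twice_diff g"
  shows "twice_diff (\<lambda>t. f t - g t)"
  using twice_diff_add[OF assms(1) twice_diff_mult[OF twice_diff_const[of "-1"] assms(2)]] by simp

lemma twice_diff_power2: "twice_diff f \<Longrightarrow> twice_diff (\<lambda>t. (f t)\<^sup>2)"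
  using twice_diff_mult[of f f] by (simp add: power2_eq_square)

lemma twice_diff_sin: "twice_diff (\<lambda>t. of_real (sin (t * r / 2)))"
  and twice_diff_cos: "twice_diff (\<lambda>t. of_real (cos (t * r / 2)))"
proof -
  \<comment> \<open>The factor \<open>k\<close> lets each formula also differentiate the derivative
    supplied by the other.\<close>
  have sin: "((\<lambda>t. complex_of_real (k * sin (t * r / 2))) has_vector_derivative of_real (k * (r / 2) * cos (t * r / 2))) (at t)"
    and cos: "((\<lambda>t. complex_of_real (k * cos (t * r / 2))) has_vector_derivative of_real (- k * (r / 2) * sin (t * r / 2))) (at t)"
    for k t
    by (rule has_vector_derivative_of_real, auto intro!: derivative_eq_intros)+
  show "twice_diff (\<lambda>t. of_real (sin (t * r / 2)))"
    using twice_diffI[OF sin[of 1] cos] by simp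
  show "twice_diff (\<lambda>t. of_real (cos (t * r / 2)))"
    using twice_diffI[OF cos[of 1] sin] by simp
qed

lemmas twice_diff_intros = twice_diff_const twice_diff_add twice_diff_mult twice_diff_cnj
  twice_diff_diff twice_diff_power2 twice_diff_sin twice_diff_cos

lemma twice_diff_continuous: "twice_diff f \<Longrightarrow> continuous_on UNIV f"
  unfolding twice_diff_def
  by (metis continuous_at_imp_continuous_on has_vector_derivative_continuous)

text \<open>The curve is a product of two SU(2) elements, so it stays in the group and its
  parameters are trigonometric in \<open>t\<close>.\<close>

lemma curve_rho:
  assumes "U \<in> Rgrp"
  obtains f g where "twice_diff f" "twice_diff g" "\<And>t. (cmod (f t))\<^sup>2 + (cmod (g t))\<^sup>2 = 1"
    "\<And>t. curve U v t = rho (f t) (g t)" "curve U v 0 = U"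
proof -
  obtain a b where U: "U = rho a b" and ab: "(cmod a)\<^sup>2 + (cmod b)\<^sup>2 = 1"
    using assms unfolding Rgrp_eq by blast
  obtain r u where u: "norm u = 1" and v: "v = r *\<^sub>R u"
  proof (cases "v = 0")
    case True
    then show ?thesis using that[of "axis 1 1" 0] by simp
  next
    case False
    then show ?thesis using that[of "v /\<^sub>R norm v" "norm v"] by simp
  qed
  define c where "c t = complex_of_real (cos (t * r / 2)) - \<i> * of_real (sin (t * r / 2)) * of_real (u $ 3)" for t
  define d where "d t = - \<i> * complex_of_real (sin (t * r / 2)) * (of_real (u $ 1) + \<i> * of_real (u $ 2))" for t
  have cv: "curve U v t = rho (a * c t - cnj b * d t) (b * c t + cnj a * d t)" for t
    unfolding curve_def U v mexp_gen[OF u] c_def[symmetric] d_def[symmetric] rho_mult ..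
  have cd: "(cmod (c t))\<^sup>2 + (cmod (d t))\<^sup>2 = 1" for t
  proof -
    have "(u $ 1)\<^sup>2 + (u $ 2)\<^sup>2 + (u $ 3)\<^sup>2 = 1" using norm_vec3[of u] u by simp
    moreover have "(cmod (c t))\<^sup>2 + (cmod (d t))\<^sup>2 = (cos (t * r / 2))\<^sup>2
        + (sin (t * r / 2))\<^sup>2 * ((u $ 1)\<^sup>2 + (u $ 2)\<^sup>2 + (u $ 3)\<^sup>2)"
      unfolding cmod_power2 c_def d_def by (simp add: power_mult_distrib algebra_simps)
    ultimately show ?thesis by simp
  qed
  \<comment> \<open>Euler's four-square identity: the norm of quaternions is multiplicative.\<close>
  have id: "(cmod (a * c - cnj b * d))\<^sup>2 + (cmod (b * c + cnj a * d))\<^sup>2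
     = ((cmod a)\<^sup>2 + (cmod b)\<^sup>2) * ((cmod c)\<^sup>2 + (cmod d)\<^sup>2)" for c d
    unfolding cmod_power2 by simp algebra
  show ?thesis
  proof (rule that[OF _ _ _ cv])
    show "twice_diff (\<lambda>t. a * c t - cnj b * d t)" "twice_diff (\<lambda>t. b * c t + cnj a * d t)"
      unfolding c_def d_def by (intro twice_diff_intros)+
    show "(cmod (a * c t - cnj b * d t))\<^sup>2 + (cmod (b * c t + cnj a * d t))\<^sup>2 = 1" for t
      unfolding id ab cd by simp
    show "curve U v 0 = U"
      unfolding cv unfolding U by (simp add: c_def d_def)
  qed
qed

text \<open>The second-order condition for minima is applied to \<open>- P\<close> along the
  curve.\<close>

lemma hess_nonpos_at_local_max:
  assumes "local_max U1 U2" "U1 \<in> Rgrp" "U2 \<in> Rgrp"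
  shows "hess U1 U2 v w \<le> 0"
proof -
  obtain f g where fg: "twice_diff f" "twice_diff g" "\<And>t. (cmod (f t))\<^sup>2 + (cmod (g t))\<^sup>2 = 1"
    "\<And>t. curve U1 v t = rho (f t) (g t)" "curve U1 v 0 = U1"
    using curve_rho[OF assms(2), of v] by blast
  obtain k l where kl: "twice_diff k" "twice_diff l" "\<And>t. (cmod (k t))\<^sup>2 + (cmod (l t))\<^sup>2 = 1"
    "\<And>t. curve U2 w t = rho (k t) (l t)" "curve U2 w 0 = U2"
    using curve_rho[OF assms(3), of w] by blast
  obtain e where e: "e > 0"
    "\<And>V1 V2. V1 \<in> Rgrp \<Longrightarrow> V2 \<in> Rgrp \<Longrightarrow> dist (V1, V2) (U1, U2) < e \<Longrightarrow> Pfun V1 V2 \<le> Pfun U1 U2"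
    using assms(1) unfolding local_max_def by blast
  have "continuous_on UNIV (\<lambda>t. (curve U1 v t, curve U2 w t))"
    unfolding fg(4) kl(4)
    by (intro continuous_intros twice_diff_continuous fg(1,2) kl(1,2))
  then obtain d where d: "d > 0"
    "\<And>t. dist t 0 < d \<Longrightarrow> dist (curve U1 v t, curve U2 w t) (curve U1 v 0, curve U2 w 0) < e"
    using e(1) unfolding continuous_on_iff by (meson UNIV_I)
  have max: "Pcurve U1 U2 v w t \<le> Pcurve U1 U2 v w 0" if "\<bar>t - 0\<bar> < d" for t
  proof -
    have "curve U1 v t \<in> Rgrp" "curve U2 w t \<in> Rgrp"
      unfolding Rgrp_eq using fg(3,4) kl(3,4) by blast+
    then show ?thesis using e(2) d(2)[of t] that by (simp add: Pcurve_def fg(5) kl(5))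
  qed
  \<comment> \<open>The witness is the complex polynomial inside \<open>Re\<close> in
    \<open>Pfun_rho\<close>, found by unification with \<open>refl\<close>.\<close>
  have "\<exists>F. twice_diff F \<and> Pcurve U1 U2 v w = (\<lambda>t. Re (F t))"
    unfolding Pcurve_def[abs_def] fg(4) kl(4) Pfun_rho
    by (rule exI, rule conjI[OF _ refl]) (intro twice_diff_intros fg(1,2) kl(1,2))
  then obtain F F' F'' where F: "Pcurve U1 U2 v w = (\<lambda>t. Re (F t))"
    "\<And>t. (F has_vector_derivative F' t) (at t)" "\<And>t. (F' has_vector_derivative F'' t) (at t)"
    unfolding twice_diff_def by metis
  have P1: "(Pcurve U1 U2 v w has_real_derivative Re (F' t)) (at t)" for t
    unfolding F(1) has_real_derivative_iff_has_vector_derivative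
    by (rule bounded_linear.has_vector_derivative[OF bounded_linear_Re F(2)])
  have P2: "((\<lambda>t. Re (F' t)) has_real_derivative Re (F'' t)) (at t)" for t
    unfolding has_real_derivative_iff_has_vector_derivative
    by (rule bounded_linear.has_vector_derivative[OF bounded_linear_Re F(3)])
  have "deriv (Pcurve U1 U2 v w) = (\<lambda>t. Re (F' t))"
    using P1 by (intro ext DERIV_imp_deriv)
  then have "hess U1 U2 v w = Re (F'' 0)"
    unfolding hess_def using P2[of 0] by (simp add: DERIV_imp_deriv)
  moreover have "- Re (F'' 0) \<ge> 0"
    by (rule local_min_deriv2(2)[OF DERIV_minus[OF P1] DERIV_minus[OF P2] d(1)]) (use max in simp)
  ultimately show ?thesis by simp
qed

text \<open>The first basis vector is an eigenvector of \<open>Jz\<close>, so this curve only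
  changes the phase of the state \<open>U1\<close> prepares, and \<open>P\<close> is constant along
  it.\<close>

lemma hess_Jz_direction:
  assumes "U1 \<in> Rgrp" "U2 \<in> Rgrp"
  shows "hess U1 U2 (axis 3 1) 0 = 0"
proof -
  obtain a b where U1: "U1 = rho a b" using assms(1) unfolding Rgrp_eq by blast
  obtain c d where U2: "U2 = rho c d" using assms(2) unfolding Rgrp_eq by blast
  have "Pcurve U1 U2 (axis 3 1) 0 t = Pfun U1 U2" for t
  proof -
    define z where "z = cis (- t / 2)"
    have z: "z * cnj z = 1" by (simp add: z_def cis_cnj cis_mult)
    have cz: "complex_of_real (cos (t/2)) - \<i> * of_real (sin (t/2)) = z"
      by (simp add: complex_eq_iff z_def)
    have c1: "curve U1 (axis 3 1) t = rho (a * z) (b * z)"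
      unfolding curve_def U1
      using mexp_gen[of "axis 3 1" t 1, OF norm_axis_1] by (simp add: axis_def cz rho_mult)
    have c2: "curve U2 0 t = U2"
      unfolding curve_def U2
      using mexp_gen[of "axis 3 1" t 0, OF norm_axis_1] by (simp add: rho_mult)
    define W where "W = a * b * (c * cnj c - d * cnj d) - cnj c * cnj d * b\<^sup>2"
    have W: "a * z * (b * z) * (c * cnj c - d * cnj d) - cnj c * cnj d * (b * z)\<^sup>2 = z\<^sup>2 * W"
      by (simp add: W_def algebra_simps power2_eq_square)
    have zz: "(a * z) * cnj (a * z) = a * cnj a"
      "(of_real (sqrt 2) * (z\<^sup>2 * W)) * cnj (of_real (sqrt 2) * (z\<^sup>2 * W))
        = (of_real (sqrt 2) * W) * cnj (of_real (sqrt 2) * W)"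
    proof -
      show "(a * z) * cnj (a * z) = a * cnj a" using z by (simp add: mult_ac)
      have "(of_real (sqrt 2) * (z\<^sup>2 * W)) * cnj (of_real (sqrt 2) * (z\<^sup>2 * W))
        = (of_real (sqrt 2) * W) * cnj (of_real (sqrt 2) * W) * (z * cnj z)\<^sup>2"
        by (simp add: mult_ac power_mult_distrib)
      then show "(of_real (sqrt 2) * (z\<^sup>2 * W)) * cnj (of_real (sqrt 2) * (z\<^sup>2 * W))
        = (of_real (sqrt 2) * W) * cnj (of_real (sqrt 2) * W)" using z by simp
    qed
    show ?thesis
      unfolding Pcurve_def c1 c2 unfolding U1 U2 Pfun_rho W zz(1) unfolding W_def[symmetric] zz(2) ..
  qed
  then have "Pcurve U1 U2 (axis 3 1) 0 = (\<lambda>t. Pfun U1 U2)" by blast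
  then show ?thesis by (simp add: hess_def)
qed

theorem theorem1:
  assumes "critical U1 U2"
  shows "(global_min U1 U2 \<and> Pfun U1 U2 = 0) \<or> saddle U1 U2 \<or> second_order_trap U1 U2 \<or>
         (global_max U1 U2 \<and> Pfun U1 U2 = 3 / 50 * (9 + sqrt 6))"
proof -
  have U: "U1 \<in> Rgrp" "U2 \<in> Rgrp" using assms by (simp_all add: critical_def)
  consider "local_min U1 U2" | "local_max U1 U2" | "\<not> local_min U1 U2" "\<not> local_max U1 U2" by blast
  then show ?thesis
  proof cases
    case 1
    then have "Pfun U1 U2 = 0" using Pfun_local_min U by blast
    then show ?thesis using Pfun_nonneg by (simp add: global_min_def)
  next
    case 2
    show ?thesis
    proof (cases "global_max U1 U2")
      case True
      then show ?thesis using global_max_imp_Pmax U by (simp add: Pmax_def)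
    next
      case False
      have "(axis 3 1 :: real ^ 3, 0 :: real ^ 3) \<noteq> 0" by (simp add: zero_prod_def)
      then have "second_order_trap U1 U2"
        unfolding second_order_trap_def
        using assms False hess_nonpos_at_local_max[OF 2 U] hess_Jz_direction[OF U]
        by (metis less_irrefl)
      then show ?thesis by blast
    qed
  next
    case 3
    then show ?thesis using assms by (simp add: saddle_def)
  qed
qed

thm_deps theorem1

end
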